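(* Let $E$ be a finite-dimensional evolution algebra over $\mathbb{C}$. Then the derived series of $E$ stabilises, i.e. there is an index $m$ such that $E^{(r)}=E^{(m)}$ for all $r\ge m$. Let $D$ denote its stable term. If $D$ is an evolution algebra under the induced multiplication, then the following conditions are equivalent: (i) $E$ is solvable; (ii) $E$ has no non-zero idempotents.
   Context: An evolution algebra over a field $\mathbb{K}$ is a commutative, not necessarily associative, $\mathbb{K}$-algebra $E$ admitting a basis $\{e_1,\dots,e_n\}$ (called a natural basis) with $e_ie_j=0$ for all $i\ne j$. For subspaces $U,V$ of an algebra, $UV$ denotes the linear span of the products $uv$ with $u\in U$, $v\in V$. The derived series of an algebra $A$ is $A^{(1)}=A$, $A^{(m+1)}=A^{(m)}A^{(m)}$ for $m\ge1$; $A$ is solvable if $A^{(m)}=0$ for some $m$. Each $A^{(m)}$ is a subalgebra of $A$. The stable term of a derived series that stabilises is the common value $A^{(r)}$ for all large $r$. An idempotent is an element $x$ with $x^2=x$. That $D$ is an evolution algebra means that $D$ itself has some natural basis (not required to be related to a natural basis of $E$). *)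

theory Defs
  imports Complex_Main
begin

text \<open>
  A not necessarily associative, not necessarily unital algebra over a field: the whole type
  \<open>'a\<close>, with scalar multiplication \<open>scale\<close> and bilinear product \<open>mult\<close>.
\<close>

locale nonassoc_algebra = vector_space scale
  for scale :: "'k::field \<Rightarrow> 'a::ab_group_add \<Rightarrow> 'a" +
  fixes mult :: "'a \<Rightarrow> 'a \<Rightarrow> 'a" (infixl "\<cdot>" 70)
  assumes linear_mult_right: "Vector_Spaces.linear scale scale (\<lambda>y. x \<cdot> y)"
    and linear_mult_left: "Vector_Spaces.linear scale scale (\<lambda>x. x \<cdot> y)"
begin

text \<open>
  Algebras are represented by their carriers \<open>A\<close>, with the operations induced from the ambient
  algebra, so that the same notions apply to the whole algebra (\<open>A = UNIV\<close>) and to subalgebras.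
\<close>

definition subalgebra :: "'a set \<Rightarrow> bool" where
  "subalgebra A \<longleftrightarrow> subspace A \<and> (\<forall>x\<in>A. \<forall>y\<in>A. x \<cdot> y \<in> A)"

text \<open>
  A basis is a set of vectors; the basis vectors \<open>e\<^sub>i\<close>, \<open>e\<^sub>j\<close> with \<open>i \<noteq> j\<close> are its distinct elements.
\<close>

definition natural_basis :: "'a set \<Rightarrow> 'a set \<Rightarrow> bool" where
  "natural_basis A B \<longleftrightarrow>
     finite B \<and> independent B \<and> span B = A \<and>
     (\<forall>b\<in>B. \<forall>c\<in>B. b \<noteq> c \<longrightarrow> b \<cdot> c = 0)"

text \<open>Finite-dimensional, since natural bases are finite; the zero algebra is included.\<close>

definition evolution_algebra :: "'a set \<Rightarrow> bool" where
  "evolution_algebra A \<longleftrightarrow>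
     subalgebra A \<and> (\<forall>x\<in>A. \<forall>y\<in>A. x \<cdot> y = y \<cdot> x) \<and> (\<exists>B. natural_basis A B)"

definition subspace_prod :: "'a set \<Rightarrow> 'a set \<Rightarrow> 'a set" where
  "subspace_prod U V = span {u \<cdot> v | u v. u \<in> U \<and> v \<in> V}"

text \<open>The series starts at index 1; the value at index 0 is a dummy.\<close>

fun derived_series :: "'a set \<Rightarrow> nat \<Rightarrow> 'a set" where
  "derived_series A 0 = A"
| "derived_series A (Suc 0) = A"
| "derived_series A (Suc (Suc m)) =
     subspace_prod (derived_series A (Suc m)) (derived_series A (Suc m))"

definition solvable :: "'a set \<Rightarrow> bool" where
  "solvable A \<longleftrightarrow> (\<exists>m\<ge>1. derived_series A m = {0})"

definition stable_term :: "'a set \<Rightarrow> 'a set \<Rightarrow> bool" where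
  "stable_term A D \<longleftrightarrow> (\<exists>m\<ge>1. \<forall>r\<ge>m. derived_series A r = D)"

definition idempotent :: "'a \<Rightarrow> bool" where
  "idempotent x \<longleftrightarrow> x \<cdot> x = x"

end

end

theory Submission
  imports Defs "HOL-Library.Multiset" "HOL-Computational_Algebra.Fundamental_Theorem_Algebra"
begin

text \<open>
  The stable term \<open>D\<close> is perfect, \<open>DD = D\<close>, so if \<open>D \<noteq> 0\<close> has a natural basis \<open>B\<close>, then
  every \<open>b \<in> B\<close> is a combination \<open>b = (\<Sum>c\<in>B. A b c * c\<^sup>2)\<close> with \<open>A\<close> invertible, and an element with
  coordinates \<open>x\<close> is idempotent as soon as \<open>x\<^sub>c\<^sup>2 = (\<Sum>b\<in>B. A b c * x\<^sub>b)\<close> for all \<open>c\<close>.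
  These quadrics have a common zero other than the origin. Indeed, the squarefree monomials form a
  basis of the quotient of the polynomial ring by the ideal they generate; if the origin were the
  only common zero, then the ideal \<open>m\<close> of the variables would be nilpotent in the quotient, while
  invertibility of \<open>A\<close> gives \<open>m = m\<^sup>2\<close>, hence \<open>m = 0\<close>, a contradiction. This argument is carried
  out in the dual of the quotient, whose elements are the arrays subject to a linear recurrence, so
  that multiplication by variables becomes a family of commuting shifts.
\<close>

section \<open>Polynomials in a shift operator and eigenvectors of commuting shifts\<close>

lemma sum_coeff_bound:
  fixes g :: "nat \<Rightarrow> complex"
  assumes "degree p \<le> n"
  shows "(\<Sum>k\<le>degree p. coeff p k * g k) = (\<Sum>k\<le>n. coeff p k * g k)"
  by (rule sum.mono_neutral_left) (use assms in \<open>auto simp: coeff_eq_0\<close>)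

text \<open>The function \<open>p(T) f\<close>, where \<open>T\<close> is the operator
  \<open>f \<mapsto> f \<circ> t\<close>.\<close>

definition poly_act :: "('b \<Rightarrow> 'b) \<Rightarrow> complex poly \<Rightarrow> ('b \<Rightarrow> complex) \<Rightarrow> 'b \<Rightarrow> complex" where
  "poly_act t p f x = (\<Sum>k\<le>degree p. coeff p k * f ((t ^^ k) x))"

lemma poly_act_add: "poly_act t (p + q) f x = poly_act t p f x + poly_act t q f x"
proof -
  define n where "n = max (degree p) (degree q)"
  have "degree (p + q) \<le> n" "degree p \<le> n" "degree q \<le> n"
    unfolding n_def by (auto intro: degree_add_le_max)
  note sum_coeff_bound[OF this(1)] sum_coeff_bound[OF this(2)] sum_coeff_bound[OF this(3)]
  then show ?thesis
    unfolding poly_act_def by (simp only: coeff_add sum.distrib distrib_right)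
qed

lemma poly_act_smult: "poly_act t (smult c p) f x = c * poly_act t p f x"
  unfolding poly_act_def
  by (subst sum_coeff_bound[of "smult c p" "degree p"])
     (simp_all add: degree_smult_le sum_distrib_left mult.assoc)

lemma poly_act_pCons: "poly_act t (pCons c p) f x = c * f x + poly_act t p f (t x)"
proof -
  have "poly_act t (pCons c p) f x
      = (\<Sum>k\<le>Suc (degree p). coeff (pCons c p) k * f ((t ^^ k) x))"
    unfolding poly_act_def by (rule sum_coeff_bound) (rule degree_pCons_le)
  also have "\<dots> = c * f x + (\<Sum>k\<le>degree p. coeff p k * f ((t ^^ k) (t x)))"
    by (subst sum.atMost_Suc_shift) (simp add: funpow_swap1)
  finally show ?thesis by (simp add: poly_act_def)
qed

lemma poly_act_0 [simp]: "poly_act t 0 f x = 0"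
  by (simp add: poly_act_def)

lemma poly_act_pCons0: "poly_act t (pCons 0 p) f = poly_act t p (f \<circ> t)"
proof
  fix x
  show "poly_act t (pCons 0 p) f x = poly_act t p (f \<circ> t) x"
    unfolding poly_act_pCons by (simp add: poly_act_def funpow_swap1)
qed

lemma poly_act_linear_factor:
  "poly_act t ([:- a, 1:] * p) f x = poly_act t p f (t x) - a * poly_act t p f x"
proof -
  have "[:- a, 1:] * p = smult (- a) p + pCons 0 p" by simp
  then show ?thesis
    by (simp only: poly_act_add poly_act_smult poly_act_pCons) simp
qed

text \<open>The shape \<open>monom 1 n dvd p\<close> makes the induction work: two solutions for the smaller
  set of functionals can be chosen with disjoint supports, hence independent.\<close>

lemma common_kernel_poly:
  fixes l :: "'s \<Rightarrow> complex poly \<Rightarrow> complex"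
  assumes "finite S"
    and add: "\<And>s p q. l s (p + q) = l s p + l s q"
    and smult: "\<And>s c p. l s (smult c p) = c * l s p"
  shows "\<exists>p. p \<noteq> 0 \<and> monom 1 n dvd p \<and> (\<forall>s\<in>S. l s p = 0)"
  using \<open>finite S\<close>
proof (induction S arbitrary: n rule: finite_induct)
  case empty
  show ?case by (intro exI[of _ "monom 1 n"]) simp
next
  case (insert s S)
  obtain p where p: "p \<noteq> 0" "monom 1 n dvd p" "\<forall>s\<in>S. l s p = 0"
    using insert.IH by blast
  \<comment> \<open>The exponent exceeds \<open>degree p\<close>, so \<open>q\<close> has larger
    degree than \<open>p\<close> and is no multiple of it by a scalar.\<close>
  obtain q where q: "q \<noteq> 0" "monom 1 (n + Suc (degree p)) dvd q" "\<forall>s\<in>S. l s q = 0"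
    using insert.IH by blast
  have nq: "monom 1 n dvd q"
    using q(2) by (metis dvd_mult_left mult_monom mult_1)
  show ?case
  proof (cases "l s p = 0")
    case True
    then show ?thesis using p by auto
  next
    case False
    define r where "r = smult (l s q) p + smult (- l s p) q"
    have "r \<noteq> 0"
    proof
      assume "r = 0"
      then have "smult (l s p) q = smult (l s q) p"
        by (simp add: r_def)
      then have "q = smult (l s q / l s p) p"
        using False by (metis (no_types, lifting) divide_inverse left_inverse mult.commute
            smult_1_left smult_smult)
      then have dq: "degree q \<le> degree p" by (metis degree_smult_le)
      have "degree (monom (1::complex) (n + Suc (degree p))) \<le> degree q"
        using dvd_imp_degree_le[OF q(2) q(1)] .
      then show False using dq by (simp add: degree_monom_eq)
    qed
    moreover have "monom 1 n dvd r"
      unfolding r_def using p(2) nq by (intro dvd_add dvd_smult)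
    moreover have "\<forall>u\<in>insert s S. l u r = 0"
      using p(3) q(3) by (auto simp: r_def add smult simp del: smult_minus_left)
    ultimately show ?thesis by blast
  qed
qed

definition fun_subspace :: "('b \<Rightarrow> complex) set \<Rightarrow> bool" where
  "fun_subspace U \<longleftrightarrow> (\<lambda>x. 0) \<in> U \<and> (\<forall>f\<in>U. \<forall>g\<in>U. \<forall>a. (\<lambda>x. a * f x + g x) \<in> U)"

lemma poly_act_in:
  assumes U: "fun_subspace U" and t: "\<And>f. f \<in> U \<Longrightarrow> f \<circ> t \<in> U" and "f \<in> U"
  shows "poly_act t p f \<in> U"
  using \<open>f \<in> U\<close>
proof (induction p arbitrary: f)
  case 0
  then show ?case using U by (simp add: fun_subspace_def poly_act_def)
next
  case (pCons a p)
  have "poly_act t (pCons a p) f = (\<lambda>x. a * f x + poly_act t p (f \<circ> t) x)"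
    by (rule ext, subst poly_act_pCons0[symmetric]) (simp add: poly_act_pCons)
  moreover have "poly_act t p (f \<circ> t) \<in> U" by (intro pCons.IH t pCons.prems)
  ultimately show ?case using U pCons.prems by (simp add: fun_subspace_def)
qed

text \<open>Split a linear factor \<open>T - a\<close> off \<open>p(T)\<close>, leaving
  \<open>q(T)\<close>. If \<open>a = 0\<close>, then \<open>q(T)\<close> annihilates
  \<open>f \<circ> t\<close>; otherwise \<open>q(T) f\<close> is zero, or an eigenvector for
  \<open>a\<close>. Except in the last case, induction on the degree applies.\<close>

lemma nilpotent_or_eigenvector_poly:
  assumes U: "fun_subspace U" and t: "\<And>f. f \<in> U \<Longrightarrow> f \<circ> t \<in> U" and "f \<in> U"
    and "p \<noteq> 0" "poly_act t p f = (\<lambda>x. 0)"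
  shows "(\<exists>k. f \<circ> (t ^^ k) = (\<lambda>x. 0)) \<or>
    (\<exists>g\<in>U. g \<noteq> (\<lambda>x. 0) \<and> (\<exists>a. a \<noteq> 0 \<and> g \<circ> t = (\<lambda>x. a * g x)))"
  using assms(3-)
proof (induction "degree p" arbitrary: p f)
  case 0
  then obtain c where c: "p = [:c:]" "c \<noteq> 0"
    by (metis degree_eq_zeroE pCons_0_0)
  have "f x = 0" for x
    using fun_cong[OF 0(4), of x] c by (simp add: poly_act_pCons)
  then show ?case by (intro disjI1 exI[of _ 0]) (simp add: fun_eq_iff)
next
  case (Suc n)
  have "\<not> constant (poly p)"
    using Suc(2) by (simp add: constant_degree)
  then obtain a where "poly p a = 0"
    using fundamental_theorem_of_algebra by blast
  then obtain q where q: "p = [:- a, 1:] * q"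
    by (metis poly_eq_0_iff_dvd dvdE)
  have q0: "q \<noteq> 0" using q Suc(4) by auto
  have "degree p = 1 + degree q"
    unfolding q using q0 by (subst degree_mult_eq) auto
  then have dq: "n = degree q" using Suc(2) by simp
  show ?case
  proof (cases "a = 0")
    case True
    have "poly_act t q (f \<circ> t) = (\<lambda>x. 0)"
      using Suc(5) q True by (simp flip: poly_act_pCons0)
    then have "(\<exists>k. f \<circ> t \<circ> (t ^^ k) = (\<lambda>x. 0)) \<or>
      (\<exists>g\<in>U. g \<noteq> (\<lambda>x. 0) \<and> (\<exists>a. a \<noteq> 0 \<and> g \<circ> t = (\<lambda>x. a * g x)))"
      using Suc(1)[OF dq t[OF Suc(3)] q0] by blast
    moreover have "f \<circ> t \<circ> (t ^^ k) = f \<circ> (t ^^ Suc k)" for k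
      by (simp add: comp_assoc)
    ultimately show ?thesis by metis
  next
    case False
    show ?thesis
    proof (cases "poly_act t q f = (\<lambda>x. 0)")
      case True
      then show ?thesis using Suc(1)[OF dq Suc(3) q0] by blast
    next
      case nz: False
      have "poly_act t q f \<circ> t = (\<lambda>x. a * poly_act t q f x)"
        using Suc(5) unfolding q fun_eq_iff poly_act_linear_factor by simp
      then show ?thesis
        using nz False poly_act_in[OF U t Suc(3)] by blast
    qed
  qed
qed

text \<open>The second assumption on \<open>S\<close> says that \<open>U\<close> embeds into the space of functions on
  \<open>S\<close>; this is how finite dimensionality is expressed.\<close>

lemma nilpotent_or_eigenvector:
  assumes U: "fun_subspace U" and t: "\<And>f. f \<in> U \<Longrightarrow> f \<circ> t \<in> U"
    and "finite S" and S: "\<And>f. f \<in> U \<Longrightarrow> (\<forall>s\<in>S. f s = 0) \<Longrightarrow> f = (\<lambda>x. 0)"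
    and "f \<in> U"
  shows "(\<exists>k. f \<circ> (t ^^ k) = (\<lambda>x. 0)) \<or>
    (\<exists>g\<in>U. g \<noteq> (\<lambda>x. 0) \<and> (\<exists>a. a \<noteq> 0 \<and> g \<circ> t = (\<lambda>x. a * g x)))"
proof -
  \<comment> \<open>The polynomials have infinite dimension, while \<open>p(T) f = 0\<close> amounts
    to finitely many linear conditions on \<open>p\<close>, one for each point of
    \<open>S\<close>.\<close>
  obtain p where p: "p \<noteq> 0" "\<forall>s\<in>S. poly_act t p f s = 0"
    using common_kernel_poly[where l = "\<lambda>s p. poly_act t p f s", OF \<open>finite S\<close>]
    by (metis poly_act_add poly_act_smult)
  have "poly_act t p f = (\<lambda>x. 0)"
    using S[OF poly_act_in[OF U t \<open>f \<in> U\<close>]] p(2) by blast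
  with nilpotent_or_eigenvector_poly[OF U t \<open>f \<in> U\<close> p(1)] show ?thesis by blast
qed

text \<open>If \<open>T\<close> is nilpotent on \<open>f\<close>, the last non-zero iterate is an
  eigenvector for 0.\<close>

lemma eigenvector_exists:
  assumes U: "fun_subspace U" and t: "\<And>f. f \<in> U \<Longrightarrow> f \<circ> t \<in> U"
    and "finite S" and S: "\<And>f. f \<in> U \<Longrightarrow> (\<forall>s\<in>S. f s = 0) \<Longrightarrow> f = (\<lambda>x. 0)"
    and f: "f \<in> U" "f \<noteq> (\<lambda>x. 0)"
  shows "\<exists>g\<in>U. g \<noteq> (\<lambda>x. 0) \<and> (\<exists>a. g \<circ> t = (\<lambda>x. a * g x))"
proof (cases "\<exists>k. f \<circ> (t ^^ k) = (\<lambda>x. 0)")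
  case True
  define k where "k = (LEAST k. f \<circ> (t ^^ k) = (\<lambda>x. 0))"
  have k: "f \<circ> (t ^^ k) = (\<lambda>x. 0)"
    unfolding k_def using True by (rule LeastI_ex)
  then obtain m where m: "k = Suc m"
    using f(2) by (cases k) auto
  have nz: "f \<circ> (t ^^ m) \<noteq> (\<lambda>x. 0)"
    using not_less_Least[of m "\<lambda>k. f \<circ> (t ^^ k) = (\<lambda>x. 0)"] m k_def by simp
  have "f \<circ> (t ^^ j) \<in> U" for j
  proof (induction j)
    case (Suc j)
    then show ?case using t[of "f \<circ> (t ^^ j)"] by (simp only: comp_assoc funpow_Suc_right)
  qed (use f in simp)
  moreover have "f \<circ> (t ^^ m) \<circ> t = (\<lambda>x. 0 * (f \<circ> (t ^^ m)) x)"
    using k m by (simp add: comp_assoc funpow_Suc_right del: funpow.simps)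
  ultimately show ?thesis using nz by blast
next
  case False
  then show ?thesis using nilpotent_or_eigenvector[OF U t \<open>finite S\<close> S f(1)] by blast
qed

text \<open>Induction on \<open>F\<close>: a joint eigenspace \<open>W\<close> of the earlier shifts
  is invariant under the next one, since the shifts commute, so it contains an eigenvector of that
  shift.\<close>

lemma common_eigenvector:
  fixes t :: "'i \<Rightarrow> 'b \<Rightarrow> 'b"
  assumes "finite F" and comm: "\<And>i j x. t i (t j x) = t j (t i x)"
    and U: "fun_subspace U" and t: "\<And>f i. i \<in> F \<Longrightarrow> f \<in> U \<Longrightarrow> f \<circ> t i \<in> U"
    and "finite S" and S: "\<And>f. f \<in> U \<Longrightarrow> (\<forall>s\<in>S. f s = 0) \<Longrightarrow> f = (\<lambda>x. 0)"
    and f: "f \<in> U" "f \<noteq> (\<lambda>x. 0)"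
  shows "\<exists>g\<in>U. g \<noteq> (\<lambda>x. 0) \<and> (\<exists>a. \<forall>i\<in>F. \<forall>x. g (t i x) = a i * g x)"
  using \<open>finite F\<close> t
proof (induction F rule: finite_induct)
  case empty
  then show ?case using f by auto
next
  case (insert j F)
  obtain g a where g: "g \<in> U" "g \<noteq> (\<lambda>x. 0)" "\<forall>i\<in>F. \<forall>x. g (t i x) = a i * g x"
    using insert.IH insert.prems by (metis insertCI)
  define W where "W = {h\<in>U. \<forall>i\<in>F. \<forall>x. h (t i x) = a i * h x}"
  have "fun_subspace W"
    using U by (auto simp: fun_subspace_def W_def algebra_simps)
  moreover have "h \<circ> t j \<in> W" if "h \<in> W" for h
  proof -
    have "h \<circ> t j \<in> U" by (rule insert.prems) (use that in \<open>auto simp: W_def\<close>)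
    then show ?thesis using that by (simp add: W_def comm[of j])
  qed
  ultimately obtain h b where h: "h \<in> W" "h \<noteq> (\<lambda>x. 0)" "h \<circ> t j = (\<lambda>x. b * h x)"
    using eigenvector_exists[of W "t j" S g] \<open>finite S\<close> S g by (force simp: W_def)
  then have "\<forall>i\<in>insert j F. \<forall>x. h (t i x) = (a(j := b)) i * h x"
    using insert.hyps by (auto simp: W_def fun_eq_iff)
  moreover have "h \<in> U" using h(1) by (simp add: W_def)
  ultimately show ?case using h(2) by blast
qed

section \<open>A system of quadrics and its common zero other than the origin\<close>

text \<open>Rewrites a monomial by \<open>x_i^2 = (\<Sum>j\<in>I. L i j * x_j)\<close>, lowering the
  degree, until only squarefree monomials remain; each of these gets the value 1. The square to be
  rewritten is an arbitrary choice.\<close>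

function rec_solution :: "('i \<Rightarrow> 'i \<Rightarrow> complex) \<Rightarrow> 'i set \<Rightarrow> 'i multiset \<Rightarrow> complex" where
  "rec_solution L I M = (if \<exists>i. 2 \<le> count M i
     then \<Sum>j\<in>I. L (SOME i. 2 \<le> count M i) j *
       rec_solution L I (add_mset j (M - {#SOME i. 2 \<le> count M i, SOME i. 2 \<le> count M i#}))
     else 1)"
  by pat_completeness auto

lemma double_elem_split:
  assumes "2 \<le> count M i"
  shows "\<exists>N. M = N + {#i, i#}"
proof -
  have "{#i, i#} \<subseteq># M"
    using assms by (auto simp: subseteq_mset_def)
  then show ?thesis by (metis subset_mset.diff_add)
qed

termination
proof (relation "measure (\<lambda>(L, I, M). size M)", goal_cases)
  case (2 L I M j)
  define k where "k = (SOME i. 2 \<le> count M i)"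
  have "2 \<le> count M k" unfolding k_def using 2 by (metis someI_ex)
  then obtain N where "M = N + {#k, k#}" using double_elem_split by metis
  then show ?case unfolding k_def[symmetric] by simp
qed simp

declare rec_solution.simps [simp del]

lemma rec_solution_step:
  assumes "2 \<le> count M i"
  obtains k N where "M = N + {#k, k#}"
    "rec_solution L I M = (\<Sum>j\<in>I. L k j * rec_solution L I (add_mset j N))"
proof -
  define k where "k = (SOME i. 2 \<le> count M i)"
  have "2 \<le> count M k" unfolding k_def using assms by (metis someI_ex)
  then obtain N where N: "M = N + {#k, k#}" using double_elem_split by metis
  have "rec_solution L I M = (\<Sum>j\<in>I. L k j * rec_solution L I (add_mset j (M - {#k, k#})))"
    by (subst rec_solution.simps) (use assms in \<open>auto simp flip: k_def\<close>)
  with N show thesis by (intro that[of N k]) auto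
qed

text \<open>The rewriting is confluent: if the definition reduces the square of another variable
  \<open>k\<close>, both squares divide the monomial, and the two reductions can be
  interchanged.\<close>

lemma rec_solution_add2:
  "rec_solution L I (M + {#i, i#}) = (\<Sum>j\<in>I. L i j * rec_solution L I (add_mset j M))"
proof (induction "size M" arbitrary: M i rule: less_induct)
  case less
  have "2 \<le> count (M + {#i, i#}) i" by simp
  then obtain k N where N: "M + {#i, i#} = N + {#k, k#}"
    and rec: "rec_solution L I (M + {#i, i#}) = (\<Sum>j\<in>I. L k j * rec_solution L I (add_mset j N))"
    by (rule rec_solution_step)
  show ?case
  proof (cases "k = i")
    case True
    then show ?thesis using rec N by auto
  next
    case False
    have "2 \<le> count M k"
      using arg_cong[OF N, of "\<lambda>M. count M k"] False by simp
    then obtain P where P: "M = P + {#k, k#}" using double_elem_split by metis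
    have NP: "N = P + {#i, i#}" using N P by auto
    \<comment> \<open>After one reduction the monomial is smaller by one, so the induction
      hypothesis applies to the remaining square, whichever of the two it is.\<close>
    have IH: "rec_solution L I (add_mset j P + {#u, u#})
        = (\<Sum>l\<in>I. L u l * rec_solution L I (add_mset l (add_mset j P)))" for j u
      by (rule less) (simp add: P)
    have "rec_solution L I (M + {#i, i#})
        = (\<Sum>j\<in>I. L k j * (\<Sum>l\<in>I. L i l * rec_solution L I (add_mset l (add_mset j P))))"
      unfolding rec NP using IH[of _ i] by (simp add: add_mset_commute)
    also have "\<dots> = (\<Sum>l\<in>I. L i l * (\<Sum>j\<in>I. L k j * rec_solution L I (add_mset j (add_mset l P))))"
      unfolding sum_distrib_left
      by (subst sum.swap) (simp add: mult.left_commute add_mset_commute)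
    also have "\<dots> = (\<Sum>l\<in>I. L i l * rec_solution L I (add_mset l M))"
      using IH[of _ k] by (simp add: P add_mset_commute)
    finally show ?thesis .
  qed
qed

lemma rec_solution_singleton [simp]: "rec_solution L I {#i#} = 1"
  by (subst rec_solution.simps) auto

text \<open>Functionals on the polynomial ring in variables \<open>x\<^sub>i\<close>, \<open>i \<in> I\<close>, that vanish on the ideal
  generated by \<open>x\<^sub>i\<^sup>2 - (\<Sum>j\<in>I. L i j * x\<^sub>j)\<close>; a multiset stands for a monomial, and
  adding an element to it for the multiplication by a variable.\<close>

definition quadric_functionals :: "('i \<Rightarrow> 'i \<Rightarrow> complex) \<Rightarrow> 'i set \<Rightarrow> ('i multiset \<Rightarrow> complex) set" where
  "quadric_functionals L I = {f. (\<forall>M. \<not> set_mset M \<subseteq> I \<longrightarrow> f M = 0) \<and>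
     (\<forall>i\<in>I. \<forall>M. f (M + {#i, i#}) = (\<Sum>j\<in>I. L i j * f (add_mset j M)))}"

lemma fun_subspace_quadric_functionals: "fun_subspace (quadric_functionals L I)"
  by (auto simp: fun_subspace_def quadric_functionals_def algebra_simps sum.distrib sum_distrib_left)

lemma quadric_functionals_shift:
  "i \<in> I \<Longrightarrow> f \<in> quadric_functionals L I \<Longrightarrow> f \<circ> add_mset i \<in> quadric_functionals L I"
  unfolding quadric_functionals_def
  by (auto simp: add_mset_commute[of i])

text \<open>The recurrence reduces every monomial containing a square to smaller degree, which
  leaves the squarefree monomials in \<open>I\<close>. For finite \<open>I\<close> these serve as
  the finite set \<open>S\<close> of the eigenvector lemmas.\<close>

lemma quadric_functionals_determined:
  assumes f: "f \<in> quadric_functionals L I" and sf: "\<forall>M\<in>mset_set ` Pow I. f M = 0"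
  shows "f = (\<lambda>M. 0)"
proof
  fix M
  show "f M = 0"
  proof (induction "size M" arbitrary: M rule: less_induct)
    case less
    consider "\<not> set_mset M \<subseteq> I" | i where "2 \<le> count M i" "set_mset M \<subseteq> I"
      | "\<And>i. count M i < 2" "set_mset M \<subseteq> I"
      by (meson not_le)
    then show ?case
    proof cases
      case 1
      then show ?thesis using f by (simp add: quadric_functionals_def)
    next
      case 2
      then obtain N where N: "M = N + {#i, i#}" using double_elem_split by metis
      then have "f M = (\<Sum>j\<in>I. L i j * f (add_mset j N))"
        using f 2 by (simp add: quadric_functionals_def)
      then show ?thesis using less N by simp
    next
      case 3
      have "count M i = count (mset_set (set_mset M)) i" for i
        using 3(1)[of i] by (cases "i \<in># M") (auto simp: not_in_iff count_mset_set' le_Suc_eq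
          simp flip: count_greater_zero_iff)
      then have "M = mset_set (set_mset M)" by (rule multiset_eqI)
      then show ?thesis using sf 3(2) by blast
    qed
  qed
qed

text \<open>If all shifts were nilpotent on a functional, it would vanish on all monomials of large
  degree; the inverse of \<open>L\<close> expresses its values in degree \<open>d\<close> by those in degree
  \<open>d + 1\<close>, so it would vanish in all positive degrees.\<close>

lemma quadrics_nontrivial_zero:
  fixes L C :: "'i \<Rightarrow> 'i \<Rightarrow> complex"
  assumes "finite I" "I \<noteq> {}"
    and inv: "\<And>i k. i \<in> I \<Longrightarrow> k \<in> I \<Longrightarrow> (\<Sum>j\<in>I. L j i * C j k) = (if i = k then 1 else 0)"
  shows "\<exists>x. (\<exists>i\<in>I. x i \<noteq> 0) \<and> (\<forall>i\<in>I. x i * x i = (\<Sum>j\<in>I. L i j * x j))"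
proof -
  let ?U = "quadric_functionals L I"
  let ?S = "mset_set ` Pow I"
  have "finite ?S" using \<open>finite I\<close> by simp
  define f where "f M = (if set_mset M \<subseteq> I then rec_solution L I M else 0)" for M
  have fU: "f \<in> ?U"
    using rec_solution_add2[of L I] by (auto simp: quadric_functionals_def f_def)
  \<comment> \<open>Some shift is not nilpotent on \<open>f\<close>; it will supply a non-zero
    coordinate.\<close>
  have "\<exists>i\<in>I. \<forall>k. f \<circ> (add_mset i ^^ k) \<noteq> (\<lambda>M. 0)"
  proof (rule ccontr)
    assume "\<not> ?thesis"
    then obtain K where K: "\<And>i. i \<in> I \<Longrightarrow> f \<circ> (add_mset i ^^ K i) = (\<lambda>M. 0)" by metis
    have K': "f M = 0" if i: "i \<in> I" "K i \<le> count M i" for i M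
    proof -
      have "(add_mset i ^^ n) P = replicate_mset n i + P" for n P
        by (induction n) auto
      moreover obtain P where "M = replicate_mset (K i) i + P"
        using i(2) by (metis count_le_replicate_mset_subset_eq subset_mset.add_diff_inverse)
      ultimately show ?thesis using K[OF i(1)] by (metis comp_apply)
    qed
    \<comment> \<open>Pigeonhole: in so large a degree, some exponent in \<open>M\<close> reaches
      \<open>K i\<close>.\<close>
    have large: "f M = 0" if "size M \<ge> Suc (\<Sum>i\<in>I. K i)" for M
    proof (cases "set_mset M \<subseteq> I")
      case True
      have "\<exists>i\<in>I. K i \<le> count M i"
      proof (rule ccontr)
        assume "\<not> ?thesis"
        then have "(\<Sum>i\<in>I. count M i) \<le> (\<Sum>i\<in>I. K i)"
          by (intro sum_mono) (meson nat_le_linear)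
        moreover have "size M = (\<Sum>i\<in>I. count M i)"
          unfolding size_multiset_overloaded_eq using \<open>finite I\<close> True
          by (intro sum.mono_neutral_left) (auto simp: not_in_iff)
        ultimately show False using that by simp
      qed
      then show ?thesis using K' by blast
    qed (simp add: f_def)
    \<comment> \<open>Modulo the ideal, \<open>x_k\<close> is the combination of the squares
      \<open>x_j^2\<close> with coefficients \<open>C j k\<close>.\<close>
    have down: "f (add_mset k M) = 0" if "k \<in> I" "\<And>i. i \<in> I \<Longrightarrow> f (M + {#i, i#}) = 0" for k M
    proof -
      have "0 = (\<Sum>j\<in>I. C j k * (\<Sum>i\<in>I. L j i * f (add_mset i M)))"
        using that(2) fU by (simp add: quadric_functionals_def)
      also have "\<dots> = (\<Sum>i\<in>I. (\<Sum>j\<in>I. L j i * C j k) * f (add_mset i M))"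
        unfolding sum_distrib_left sum_distrib_right
        by (subst sum.swap) (simp add: mult_ac)
      also have "\<dots> = (\<Sum>i\<in>I. if i = k then f (add_mset k M) else 0)"
        by (rule sum.cong) (use that(1) inv in auto)
      also have "\<dots> = f (add_mset k M)"
        using that(1) \<open>finite I\<close> by simp
      finally show ?thesis by simp
    qed
    \<comment> \<open>Downward induction on the degree bound; at \<open>n = 0\<close> it reaches the
      single variables, where \<open>f\<close> has the value 1.\<close>
    have "f M = 0" if "size M \<ge> Suc n" "n \<le> (\<Sum>i\<in>I. K i)" for n M
      using that(2,1)
    proof (induction n arbitrary: M rule: inc_induct)
      case base
      then show ?case by (rule large)
    next
      case (step n)
      obtain k N where N: "M = add_mset k N" using step.prems by (cases M) auto
      show ?case
      proof (cases "k \<in> I")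
        case True
        then show ?thesis unfolding N
          by (rule down) (use step N in auto)
      qed (simp add: N f_def)
    qed
    from this[of 0] have "f {#i#} = 0" for i by simp
    moreover obtain i where "i \<in> I" using \<open>I \<noteq> {}\<close> by blast
    ultimately show False by (metis f_def rec_solution_singleton set_mset_single
      empty_subsetI insert_subset set_mset_add_mset_insert set_mset_empty zero_neq_one)
  qed
  then obtain i where i: "i \<in> I" "\<forall>k. f \<circ> (add_mset i ^^ k) \<noteq> (\<lambda>M. 0)" by blast
  have "(\<exists>k. f \<circ> (add_mset i ^^ k) = (\<lambda>M. 0)) \<or>
      (\<exists>g\<in>?U. g \<noteq> (\<lambda>M. 0) \<and> (\<exists>a. a \<noteq> 0 \<and> g \<circ> add_mset i = (\<lambda>M. a * g M)))"
    by (rule nilpotent_or_eigenvector[OF fun_subspace_quadric_functionals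
          quadric_functionals_shift[OF i(1)] \<open>finite ?S\<close> _ fU])
       (auto intro: quadric_functionals_determined)
  then obtain g a where g: "g \<in> ?U" "g \<noteq> (\<lambda>M. 0)" and a: "a \<noteq> 0"
      "g \<circ> add_mset i = (\<lambda>M. a * g M)"
    using i(2) by blast
  \<comment> \<open>Looking for the common eigenvector inside the eigenspace of
    \<open>a \<noteq> 0\<close> forces the coordinate \<open>x i = a\<close>, so the zero found is
    not the origin.\<close>
  define W where "W = {h\<in>?U. \<forall>M. h (add_mset i M) = a * h M}"
  have "\<exists>h\<in>W. h \<noteq> (\<lambda>M. 0) \<and> (\<exists>x. \<forall>j\<in>I. \<forall>M. h (add_mset j M) = x j * h M)"
  proof (rule common_eigenvector[OF \<open>finite I\<close> _ _ _ \<open>finite ?S\<close>])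
    show "fun_subspace W"
      using fun_subspace_quadric_functionals[of L I]
      by (auto simp: fun_subspace_def W_def algebra_simps)
    show "h \<circ> add_mset j \<in> W" if "j \<in> I" "h \<in> W" for h j
      using that quadric_functionals_shift[of j I h L]
      by (auto simp: W_def add_mset_commute[of j i])
    show "g \<in> W" using g a by (auto simp: W_def fun_eq_iff)
  qed (use g quadric_functionals_determined in \<open>auto simp: W_def add_mset_commute\<close>)
  then obtain h x where h: "h \<in> W" "h \<noteq> (\<lambda>M. 0)"
    and x: "\<And>j M. j \<in> I \<Longrightarrow> h (add_mset j M) = x j * h M" by blast
  obtain M where M: "h M \<noteq> 0" using h(2) by blast
  have "x i = a" using x[OF i(1), of M] h(1) M by (simp add: W_def)
  \<comment> \<open>The eigenvalues are the coordinates of the zero: evaluate \<open>h\<close> at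
    \<open>M + {#k, k#}\<close> by shifts and by the recurrence, then cancel
    \<open>h M\<close>.\<close>
  moreover have "x k * x k = (\<Sum>j\<in>I. L k j * x j)" if "k \<in> I" for k
  proof -
    have "h (M + {#k, k#}) = (\<Sum>j\<in>I. L k j * h (add_mset j M))"
      using h(1) that by (simp add: W_def quadric_functionals_def)
    then have "x k * x k * h M = (\<Sum>j\<in>I. L k j * x j) * h M"
      using that by (simp add: x sum_distrib_right mult.assoc)
    then show ?thesis using M by simp
  qed
  ultimately show ?thesis using a i by blast
qed

section \<open>Natural bases and the derived series\<close>

context nonassoc_algebra
begin

lemma mult_sum_right: "x \<cdot> (\<Sum>i\<in>I. f i) = (\<Sum>i\<in>I. x \<cdot> f i)"
proof -
  interpret l: Vector_Spaces.linear scale scale "\<lambda>z. x \<cdot> z" by (rule linear_mult_right)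
  show ?thesis by (rule l.sum)
qed

lemma mult_sum_left: "(\<Sum>i\<in>I. f i) \<cdot> x = (\<Sum>i\<in>I. f i \<cdot> x)"
proof -
  interpret l: Vector_Spaces.linear scale scale "\<lambda>z. z \<cdot> x" by (rule linear_mult_left)
  show ?thesis by (rule l.sum)
qed

lemma mult_scale_right: "x \<cdot> scale a y = scale a (x \<cdot> y)"
proof -
  interpret l: Vector_Spaces.linear scale scale "\<lambda>z. x \<cdot> z" by (rule linear_mult_right)
  show ?thesis by (rule l.scale)
qed

lemma mult_scale_left: "scale a x \<cdot> y = scale a (x \<cdot> y)"
proof -
  interpret l: Vector_Spaces.linear scale scale "\<lambda>z. z \<cdot> y" by (rule linear_mult_left)
  show ?thesis by (rule l.scale)
qed

lemma natural_basis_mult: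
  assumes "natural_basis A B"
  shows "(\<Sum>b\<in>B. scale (x b) b) \<cdot> (\<Sum>b\<in>B. scale (y b) b) = (\<Sum>b\<in>B. scale (x b * y b) (b \<cdot> b))"
proof -
  have "(\<Sum>b\<in>B. scale (x b) b) \<cdot> (\<Sum>b\<in>B. scale (y b) b)
      = (\<Sum>b\<in>B. \<Sum>c\<in>B. if c = b then scale (x b * y b) (b \<cdot> b) else 0)"
    unfolding mult_sum_left mult_sum_right
    by (intro sum.cong refl)
       (use assms in \<open>auto simp: natural_basis_def mult_scale_left mult_scale_right mult.commute\<close>)
  also have "\<dots> = (\<Sum>b\<in>B. scale (x b * y b) (b \<cdot> b))"
    using assms by (simp add: natural_basis_def)
  finally show ?thesis .
qed

lemma natural_basis_coords:
  assumes "natural_basis A B" "x \<in> A"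
  shows "\<exists>u. x = (\<Sum>b\<in>B. scale (u b) b)"
  using assms unfolding natural_basis_def by (metis (no_types, lifting) span_finite imageE)

text \<open>In coordinates, mixed products of basis vectors vanish, so every product is a
  combination of their squares.\<close>

lemma natural_basis_subspace_prod:
  assumes B: "natural_basis A B" and "x \<in> subspace_prod A A"
  shows "\<exists>u. x = (\<Sum>b\<in>B. scale (u b) (b \<cdot> b))"
  using assms(2) unfolding subspace_prod_def
proof (induction rule: span_induct_alt)
  case base
  show ?case by (intro exI[of _ "\<lambda>_. 0"]) simp
next
  case (step c z y)
  obtain v w where z: "z = v \<cdot> w" "v \<in> A" "w \<in> A" using step by blast
  obtain f g where "v = (\<Sum>b\<in>B. scale (f b) b)" "w = (\<Sum>b\<in>B. scale (g b) b)"
    using natural_basis_coords[OF B] z by meson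
  then have zz: "z = (\<Sum>b\<in>B. scale (f b * g b) (b \<cdot> b))"
    using natural_basis_mult[OF B] z by simp
  obtain u where u: "y = (\<Sum>b\<in>B. scale (u b) (b \<cdot> b))" using step by blast
  show ?case
    by (intro exI[of _ "\<lambda>b. c * (f b * g b) + u b"])
       (simp add: zz u scale_sum_right scale_left_distrib sum.distrib)
qed

lemma derived_series_Suc:
  "m \<ge> 1 \<Longrightarrow> derived_series A (Suc m) = subspace_prod (derived_series A m) (derived_series A m)"
  by (cases m) auto

lemma subspace_derived_series: "subspace A \<Longrightarrow> subspace (derived_series A m)"
  by (induction A m rule: derived_series.induct) (auto simp: subspace_prod_def)

lemma mult_in_subspace_prod: "u \<in> U \<Longrightarrow> v \<in> V \<Longrightarrow> u \<cdot> v \<in> subspace_prod U V"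
  unfolding subspace_prod_def by (rule span_base) blast

lemma subspace_prod_mono: "U \<subseteq> U' \<Longrightarrow> V \<subseteq> V' \<Longrightarrow> subspace_prod U V \<subseteq> subspace_prod U' V'"
  unfolding subspace_prod_def by (rule span_mono) blast

lemma derived_series_Suc_subset:
  assumes "subalgebra A"
  shows "derived_series A (Suc m) \<subseteq> derived_series A m"
proof (induction m)
  case (Suc m)
  show ?case
  proof (cases m)
    case 0
    have "subspace_prod A A \<subseteq> A"
      unfolding subspace_prod_def using assms by (intro span_minimal) (auto simp: subalgebra_def)
    then show ?thesis using 0 by simp
  next
    case (Suc k)
    then show ?thesis using Suc.IH by (simp add: subspace_prod_mono)
  qed
qed simp

lemma derived_series_antimono:
  "subalgebra A \<Longrightarrow> m \<le> n \<Longrightarrow> derived_series A n \<subseteq> derived_series A m"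
  by (rule lift_Suc_antimono_le[of "derived_series A"]) (rule derived_series_Suc_subset)

lemma derived_series_stabilises:
  assumes "natural_basis UNIV B"
  shows "\<exists>m\<ge>1. \<forall>r\<ge>m. derived_series UNIV r = derived_series UNIV m"
proof -
  interpret finite_dimensional_vector_space scale B
    using assms by unfold_locales (auto simp: natural_basis_def)
  \<comment> \<open>The series descends, so equal dimension means equality; it is constant from an
    index of minimal dimension on.\<close>
  define m where "m = (ARG_MIN (\<lambda>m. dim (derived_series UNIV m)) m. m \<ge> 1)"
  have m: "m \<ge> 1" "\<And>r. r \<ge> 1 \<Longrightarrow> dim (derived_series UNIV m) \<le> dim (derived_series UNIV r)"
    using arg_min_nat_lemma[of "\<lambda>m. m \<ge> 1" 1 "\<lambda>m. dim (derived_series UNIV m)"]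
    by (auto simp: m_def)
  have "derived_series UNIV r = derived_series UNIV m" if "r \<ge> m" for r
  proof (rule subspace_dim_equal)
    show "derived_series UNIV r \<subseteq> derived_series UNIV m"
      using that by (intro derived_series_antimono) (simp add: subalgebra_def)
    show "dim (derived_series UNIV m) \<le> dim (derived_series UNIV r)"
      using m that by simp
  qed (simp_all add: subspace_derived_series)
  then show ?thesis using m(1) by blast
qed

text \<open>Being its own square, an idempotent survives every step of the series.\<close>

lemma idempotent_in_derived_series:
  "idempotent x \<Longrightarrow> x \<in> A \<Longrightarrow> x \<in> derived_series A m"
  by (induction A m rule: derived_series.induct)
     (simp_all, metis idempotent_def mult_in_subspace_prod)

lemma stable_term_perfect:
  assumes "stable_term A D"
  shows "subspace_prod D D = D"
proof -
  obtain m where m: "m \<ge> 1" "\<And>r. r \<ge> m \<Longrightarrow> derived_series A r = D"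
    using assms by (auto simp: stable_term_def)
  then show ?thesis using derived_series_Suc[of m A] by simp
qed

end

section \<open>Idempotents of perfect evolution algebras and the equivalence\<close>

lemma perfect_evolution_algebra_idempotent:
  fixes scale :: "complex \<Rightarrow> 'a::ab_group_add \<Rightarrow> 'a" and mult :: "'a \<Rightarrow> 'a \<Rightarrow> 'a"
  assumes "nonassoc_algebra scale mult"
  assumes "nonassoc_algebra.natural_basis scale mult D B" "D \<noteq> {0}"
    and "nonassoc_algebra.subspace_prod scale mult D D = D"
  shows "\<exists>x. x \<noteq> 0 \<and> nonassoc_algebra.idempotent mult x"
proof -
  interpret nonassoc_algebra scale mult by fact
  have B: "natural_basis D B" and perf: "subspace_prod D D = D"
    using assms by auto
  have fin: "finite B" and ind: "independent B" and sp: "span B = D"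
    using B by (auto simp: natural_basis_def)
  have "B \<noteq> {}" using sp assms(3) by auto
  have BD: "b \<in> D" if "b \<in> B" for b using sp span_base that by blast
  \<comment> \<open>As \<open>D = DD\<close>, the squares span \<open>D\<close>. Conversely,
    \<open>C\<close> below expands the squares in \<open>B\<close>; comparing coordinates gives
    \<open>AC = 1\<close>.\<close>
  obtain A where A: "\<And>b. b \<in> B \<Longrightarrow> b = (\<Sum>c\<in>B. scale (A b c) (mult c c))"
    using natural_basis_subspace_prod[OF B] BD perf by metis
  have "\<forall>c\<in>B. \<exists>u. mult c c = (\<Sum>d\<in>B. scale (u d) d)"
    using natural_basis_coords[OF B] mult_in_subspace_prod[OF BD BD] perf by simp
  from bchoice[OF this] obtain C
    where C: "\<And>c. c \<in> B \<Longrightarrow> mult c c = (\<Sum>d\<in>B. scale (C c d) d)" by blast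
  have AC: "(\<Sum>c\<in>B. A b c * C c d) = (if b = d then 1 else 0)" if "b \<in> B" "d \<in> B" for b d
  proof -
    have "b = (\<Sum>c\<in>B. \<Sum>d\<in>B. scale (A b c * C c d) d)"
    proof -
      have "b = (\<Sum>c\<in>B. scale (A b c) (mult c c))" by (rule A[OF that(1)])
      also have "\<dots> = (\<Sum>c\<in>B. \<Sum>d\<in>B. scale (A b c * C c d) d)"
        using C by (simp add: scale_sum_right)
      finally show ?thesis .
    qed
    also have "\<dots> = (\<Sum>d\<in>B. scale (\<Sum>c\<in>B. A b c * C c d) d)"
      by (subst sum.swap) (simp add: scale_sum_left)
    finally have b: "(\<Sum>d\<in>B. scale (\<Sum>c\<in>B. A b c * C c d) d) = b" by (rule sym)
    have "scale (if b = d then 1 else 0) d = (if b = d then b else 0)" for d by simp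
    then have "(\<Sum>d\<in>B. scale ((\<Sum>c\<in>B. A b c * C c d) - (if b = d then 1 else 0)) d) = 0"
      using that fin by (simp only: scale_left_diff_distrib sum_subtractf b) simp
    from independentD[OF ind fin subset_refl this that(2)]
    show ?thesis by simp
  qed
  \<comment> \<open>\<open>A\<close> enters transposed, which turns the inverse condition on
    \<open>L\<close> into \<open>AC = 1\<close>.\<close>
  obtain x where x: "\<exists>b\<in>B. x b \<noteq> 0" "\<And>c. c \<in> B \<Longrightarrow> x c * x c = (\<Sum>b\<in>B. A b c * x b)"
    using quadrics_nontrivial_zero[OF fin \<open>B \<noteq> {}\<close>, of "\<lambda>c b. A b c" C] AC by blast
  define v where "v = (\<Sum>b\<in>B. scale (x b) b)"
  \<comment> \<open>Expanded in squares, \<open>v\<close> has coefficient \<open>x c * x c\<close>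
    at the square of \<open>c\<close>, exactly as the product of \<open>v\<close> with
    itself.\<close>
  have "v = (\<Sum>b\<in>B. scale (x b) (\<Sum>c\<in>B. scale (A b c) (mult c c)))"
    unfolding v_def using A by (intro sum.cong) auto
  also have "\<dots> = (\<Sum>c\<in>B. scale (\<Sum>b\<in>B. A b c * x b) (mult c c))"
    unfolding scale_sum_right scale_sum_left by (subst sum.swap) (simp add: mult.commute)
  also have "\<dots> = mult v v"
    unfolding v_def natural_basis_mult[OF B] using x(2) by simp
  finally have "idempotent v" by (simp add: idempotent_def)
  moreover have "v \<noteq> 0"
    using independentD[OF ind fin subset_refl, of x] x(1) unfolding v_def by blast
  ultimately show ?thesis by blast
qed

theorem proposition2p8:
  fixes scale :: "complex \<Rightarrow> 'a::ab_group_add \<Rightarrow> 'a"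
    and mult :: "'a \<Rightarrow> 'a \<Rightarrow> 'a"
  assumes "nonassoc_algebra scale mult"
    and "nonassoc_algebra.evolution_algebra scale mult (UNIV :: 'a set)"
  shows "(\<exists>m\<ge>1. \<forall>r\<ge>m.
            nonassoc_algebra.derived_series scale mult UNIV r
              = nonassoc_algebra.derived_series scale mult UNIV m) \<and>
         (\<forall>D. nonassoc_algebra.stable_term scale mult UNIV D \<longrightarrow>
            nonassoc_algebra.evolution_algebra scale mult D \<longrightarrow>
            (nonassoc_algebra.solvable scale mult UNIV \<longleftrightarrow>
               \<not> (\<exists>x. x \<noteq> 0 \<and> nonassoc_algebra.idempotent mult x)))"
proof -
  interpret nonassoc_algebra scale mult by fact
  obtain B where "natural_basis UNIV B"
    using assms(2) by (auto simp: evolution_algebra_def)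
  then have "\<exists>m\<ge>1. \<forall>r\<ge>m. derived_series UNIV r = derived_series UNIV m"
    by (rule derived_series_stabilises)
  moreover have "solvable UNIV \<longleftrightarrow> \<not> (\<exists>x. x \<noteq> 0 \<and> idempotent x)"
    if D: "stable_term UNIV D" "evolution_algebra D" for D
  proof
    assume "solvable UNIV"
    then show "\<not> (\<exists>x. x \<noteq> 0 \<and> idempotent x)"
      unfolding solvable_def using idempotent_in_derived_series[of _ UNIV] by blast
  next
    assume no: "\<not> (\<exists>x. x \<noteq> 0 \<and> idempotent x)"
    obtain B where "natural_basis D B"
      using D(2) by (auto simp: evolution_algebra_def)
    \<comment> \<open>Otherwise the perfect algebra \<open>D\<close> would contribute a non-zero
      idempotent.\<close>
    then have "D = {0}"
      using perfect_evolution_algebra_idempotent[OF assms(1)] stable_term_perfect[OF D(1)] no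
      by blast
    then show "solvable UNIV"
      using D(1) by (auto simp: stable_term_def solvable_def)
  qed
  ultimately show ?thesis by blast
qed

end
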